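(* Let $A=[a_{ij}]\in\mathbb{R}^{n\times n}$ be a nonnegative matrix with zero diagonal and let $\alpha_{ij}\in(0,1)$ be given for all $i$ and all $j\in N_i=\{j\ne i: a_{ij}>0\}$. Consider the system $\dot x_i(t)=u_i(t)$, $i=1,\dots,n$, with $x_i(t)\in\mathbb{R}$ and $$u_i=\sum_{j\in N_i}a_{ij}\operatorname{sig}(x_j-x_i)^{\alpha_{ij}}$$ (with $u_i=0$ if $N_i=\emptyset$). If $\mathcal{G}(A)$ has a spanning tree, each strongly connected component of $\mathcal{G}(A)$ is detail-balanced, and $\alpha_{ij}=\alpha_{ji}$ for all $i,j$ such that agents $i$ and $j$ are neighbors of each other (i.e. $j\in N_i$ and $i\in N_j$), then the system solves a finite-time consensus problem.
   Context: For $r\in\mathbb{R}$ and $\alpha>0$, $\operatorname{sig}(r)^\alpha:=\operatorname{sign}(r)|r|^\alpha$, with $\operatorname{sign}(0)=0$. The weighted directed graph $\mathcal{G}(A)$ has vertices $v_1,\dots,v_n$ and an edge $(v_i,v_j)$ (from $v_i$ to $v_j$) if and only if $a_{ji}>0$, with weight $a_{ji}$. It has a spanning tree if there is a vertex from which every other vertex can be reached by a directed path. A strongly connected component is an induced subgraph (with inherited weights) that is maximal subject to being strongly connected; a single vertex counts as strongly connected. A weighted directed graph with weight matrix $[a_{ij}]$ is detail-balanced (satisfies the detail balance condition in weights) if there are scalars $\omega_i>0$, one for each vertex, with $\omega_i a_{ij}=\omega_j a_{ji}$ for all pairs $i,j$ of its vertices. Solutions are differentiable functions on $[0,\infty)$.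 The system solves a finite-time consensus problem if for every initial state $x(0)\in\mathbb{R}^n$ and every solution $x(t)$ on $[0,\infty)$ with that initial state, $|x_j(t)-x_k(t)|\to0$ as $t\to\infty$ for all $j,k$, and there exist a time $t^*$ and a real number $\kappa$ such that $x_j(t)=\kappa$ for all $t\ge t^*$ and all $j$. *)

theory Defs
  imports "Graph_Theory.Digraph_Component" "HOL-Analysis.Analysis"
begin

definition sig :: "real \<Rightarrow> real \<Rightarrow> real" where
  "sig r \<alpha> = sgn r * \<bar>r\<bar> powr \<alpha>"

definition neighbors :: "real ^ 'n ^ 'n \<Rightarrow> 'n \<Rightarrow> 'n set" where
  "neighbors A i = {j. j \<noteq> i \<and> A $ i $ j > 0}"

text \<open>An arc from \<open>i\<close> to \<open>j\<close> carries the weight \<open>A $ j $ i\<close>: information flows from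
  \<open>i\<close> to \<open>j\<close>, so the indices are transposed.\<close>

definition graph_of :: "real ^ 'n ^ 'n \<Rightarrow> ('n, 'n \<times> 'n) pre_digraph" where
  "graph_of A = with_proj \<lparr>pverts = UNIV, parcs = {(i, j). A $ j $ i > 0}\<rparr>"

text \<open>A directed (rooted) notion, unlike the library's \<^const>\<open>spanning_tree\<close>, which
  ignores the orientation of arcs when testing connectedness.\<close>

definition has_spanning_tree :: "('a, 'b) pre_digraph \<Rightarrow> bool" where
  "has_spanning_tree G \<longleftrightarrow> (\<exists>r \<in> verts G. \<forall>v \<in> verts G. v \<noteq> r \<longrightarrow> r \<rightarrow>\<^sup>*\<^bsub>G\<^esub> v)"

text \<open>Detail balance for an induced subgraph \<open>H\<close> of \<open>graph_of A\<close>: inheriting the weights, \<open>H\<close>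
  has the submatrix of \<open>A\<close> on \<open>verts H\<close> as its weight matrix.\<close>

definition detail_balanced :: "real ^ 'n ^ 'n \<Rightarrow> ('n, 'b) pre_digraph \<Rightarrow> bool" where
  "detail_balanced A H \<longleftrightarrow>
    (\<exists>\<omega> :: 'n \<Rightarrow> real. (\<forall>i \<in> verts H. \<omega> i > 0) \<and>
      (\<forall>i \<in> verts H. \<forall>j \<in> verts H. \<omega> i * A $ i $ j = \<omega> j * A $ j $ i))"

definition protocol :: "real ^ 'n ^ 'n \<Rightarrow> ('n \<Rightarrow> 'n \<Rightarrow> real) \<Rightarrow> real ^ 'n \<Rightarrow> real ^ 'n" where
  "protocol A \<alpha> x = (\<chi> i. \<Sum>j \<in> neighbors A i. A $ i $ j * sig (x $ j - x $ i) (\<alpha> i j))"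

text \<open>Functions on \<open>[0, \<infinity>)\<close> are represented by functions on the reals whose values at negative
  times are irrelevant; the derivative at \<open>0\<close> is one-sided.\<close>

definition is_solution :: "(real ^ 'n \<Rightarrow> real ^ 'n) \<Rightarrow> (real \<Rightarrow> real ^ 'n) \<Rightarrow> bool" where
  "is_solution f x \<longleftrightarrow> (\<forall>t\<ge>0. (x has_vector_derivative f (x t)) (at t within {0..}))"

definition solves_finite_time_consensus :: "(real ^ 'n \<Rightarrow> real ^ 'n) \<Rightarrow> bool" where
  "solves_finite_time_consensus f \<longleftrightarrow>
    (\<forall>x\<^sub>0 x. is_solution f x \<and> x 0 = x\<^sub>0 \<longrightarrow>
      (\<forall>j k. ((\<lambda>t. \<bar>x t $ j - x t $ k\<bar>) \<longlongrightarrow> 0) at_top) \<and>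
      (\<exists>t' \<kappa>. t' \<ge> 0 \<and> (\<forall>t\<ge>t'. \<forall>j. x t $ j = \<kappa>)))"

end

theory Submission
  imports Defs
begin

text \<open>
  Consensus is reached one strongly connected component at a time, in the order of information
  flow. Suppose that all agents influencing a component \<open>C\<close> from outside already rest at a common
  value \<open>\<kappa>\<close>, and let \<open>\<omega>\<close> be the weights of detail balance on \<open>C\<close>. The function
  \<open>V t = (\<Sum>i\<in>C. \<omega> i * (X t $ i - \<kappa>)\<^sup>2)\<close> then decreases at least as fast as
  \<open>\<Sum>\<close> \<open>\<omega> i * A $ i $ j * \<bar>X t $ j - X t $ i\<bar> powr (1 + \<alpha> i j)\<close>, summed over the edges into \<open>C\<close>:
  detail balance and the symmetry of \<open>\<alpha>\<close> make the interaction inside \<open>C\<close> antisymmetric, and the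
  resting agents only attract (\<open>dissipation_inequality\<close>).

  By connectivity, a large deviation from \<open>\<kappa>\<close> produces a large difference along some edge into
  \<open>C\<close> (\<open>path_difference_bound\<close>). Since all exponents are below \<open>1\<close>, the dissipation is therefore
  at least \<open>c * V t powr \<beta>\<close> for some \<open>c > 0\<close> and \<open>\<beta> < 1\<close>, which drives \<open>V\<close> to zero in finite time
  (\<open>consensus_on_component\<close>, \<open>finite_time_extinction\<close>).

  The component of the root receives no information from outside. There \<open>\<kappa>\<close> is the
  \<open>\<omega>\<close>-weighted mean of the states, which is constant in time by the same antisymmetry
  (\<open>weighted_mean_conserved\<close>). Every other component is reached from the root, so the value found
  there is inherited by all agents (\<open>ancestral_consensus_grows\<close>).
\<close>

section \<open>Extinction in finite time\<close>

lemma mvt_upper_bound: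
  fixes f :: "real \<Rightarrow> real"
  assumes "a \<le> b"
    and "\<And>t. a \<le> t \<Longrightarrow> t \<le> b \<Longrightarrow> (f has_real_derivative f' t) (at t within {a..})"
    and "\<And>t. a \<le> t \<Longrightarrow> t \<le> b \<Longrightarrow> f' t \<le> m"
  shows "f b \<le> f a + m * (b - a)"
proof (cases "a = b")
  case False
  then have "a < b" using assms(1) by simp
  have "\<exists>t\<in>{a<..<b}. f b - f a = f' t * (b - a)"
  proof (rule mvt_simple[OF \<open>a < b\<close>])
    fix t assume "a \<le> t" "t \<le> b"
    then show "(f has_derivative (*) (f' t)) (at t within {a..b})"
      using assms(2)[of t] unfolding has_field_derivative_def
      by (auto intro: has_derivative_subset)
  qed
  then obtain t where "a < t" "t < b" "f b - f a = f' t * (b - a)" by auto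
  moreover have "f' t * (b - a) \<le> m * (b - a)"
    using assms(3)[of t] calculation \<open>a < b\<close> by (intro mult_right_mono) auto
  ultimately show ?thesis by linarith
qed simp

text \<open>As long as \<open>V\<close> is positive, \<open>V powr (1 - \<beta>)\<close> has derivative at most \<open>- c * (1 - \<beta>)\<close>; a
  positive quantity cannot keep decreasing at a fixed rate, and because \<open>V\<close> is nonincreasing it
  cannot recover once it has vanished. This is where exponents \<open>\<beta> < 1\<close> give a finite time
  instead of mere convergence.\<close>

lemma finite_time_extinction:
  fixes V :: "real \<Rightarrow> real"
  assumes deriv: "\<And>t. T \<le> t \<Longrightarrow> (V has_real_derivative V' t) (at t within {T..})"
    and nonneg: "\<And>t. T \<le> t \<Longrightarrow> 0 \<le> V t"
    and decr: "\<And>t. T \<le> t \<Longrightarrow> V' t \<le> 0"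
    and decay: "\<And>t. T \<le> t \<Longrightarrow> 0 < V t \<Longrightarrow> V' t \<le> - (c * V t powr \<beta>)"
    and "0 < c" "\<beta> < 1"
  obtains T' where "T \<le> T'" "\<And>t. T' \<le> t \<Longrightarrow> V t = 0"
proof -
  have antimono: "V t \<le> V s" if "T \<le> s" "s \<le> t" for s t
    using mvt_upper_bound[of s t V V' 0] that decr
    by (force intro: DERIV_subset deriv)
  \<comment> \<open>The time at which the linear upper bound for \<open>V powr (1 - \<beta>)\<close> reaches zero.\<close>
  define T' where "T' = T + V T powr (1 - \<beta>) / (c * (1 - \<beta>))"
  have "T \<le> T'" using assms(5,6) by (simp add: T'_def)
  have "V T' = 0"
  proof (rule ccontr)
    assume "V T' \<noteq> 0"
    then have pos: "0 < V t" if "T \<le> t" "t \<le> T'" for t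
      using nonneg[OF \<open>T \<le> T'\<close>] antimono[OF that] by simp
    have "V T' powr (1 - \<beta>) \<le> V T powr (1 - \<beta>) + (- (c * (1 - \<beta>))) * (T' - T)"
    proof (rule mvt_upper_bound[OF \<open>T \<le> T'\<close>])
      fix t assume t: "T \<le> t" "t \<le> T'"
      show "((\<lambda>t. V t powr (1 - \<beta>)) has_real_derivative
          (1 - \<beta>) * V t powr (- \<beta>) * V' t) (at t within {T..})"
        using DERIV_chain2[OF has_real_derivative_powr[OF pos[OF t], of "1 - \<beta>"] deriv[OF t(1)]] by simp
      have "(1 - \<beta>) * V t powr (- \<beta>) * V' t
          \<le> (1 - \<beta>) * V t powr (- \<beta>) * (- (c * V t powr \<beta>))"
        using decay[OF t(1) pos[OF t]] \<open>\<beta> < 1\<close> by (intro mult_left_mono) auto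
      also have "\<dots> = - (c * (1 - \<beta>)) * (V t powr (- \<beta>) * V t powr \<beta>)"
        by (simp add: algebra_simps)
      also have "V t powr (- \<beta>) * V t powr \<beta> = 1"
        using pos[OF t] by (simp add: powr_minus)
      finally show "(1 - \<beta>) * V t powr (- \<beta>) * V' t \<le> - (c * (1 - \<beta>))" by simp
    qed
    also have "\<dots> = 0" using \<open>0 < c\<close> \<open>\<beta> < 1\<close> by (simp add: T'_def)
    finally show False using pos[OF \<open>T \<le> T'\<close>] by simp
  qed
  show thesis
  proof (rule that[OF \<open>T \<le> T'\<close>])
    fix t assume "T' \<le> t"
    with antimono[OF \<open>T \<le> T'\<close> this] nonneg[of t] \<open>V T' = 0\<close> \<open>T \<le> T'\<close> show "V t = 0" by simp
  qed
qed

section \<open>Dissipation in a detail-balanced component\<close>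

lemma mult_sig: "r * sig r a = \<bar>r\<bar> powr (1 + a)"
  by (cases "r = 0") (auto simp: sig_def powr_add sgn_if)

lemma sig_minus: "sig (- r) a = - sig r a"
  by (simp add: sig_def sgn_if)

text \<open>Summing over all agents instead of the neighbours makes the index set independent of \<open>i\<close>, so
  that double sums can be rearranged.\<close>

lemma protocol_nth:
  assumes "\<And>i j. 0 \<le> A $ i $ j"
  shows "protocol A \<alpha> x $ i = (\<Sum>j\<in>UNIV. A $ i $ j * sig (x $ j - x $ i) (\<alpha> i j))"
proof -
  have "A $ i $ j * sig (x $ j - x $ i) (\<alpha> i j) = 0" if "j \<notin> neighbors A i" for j
    using that assms[of i j] by (auto simp: neighbors_def sig_def)
  then show ?thesis
    by (auto simp: protocol_def intro!: sum.mono_neutral_left)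
qed

text \<open>Discrete integration by parts: exchanging the two indices turns one half of the left-hand side
  into minus the same sum weighted by \<open>z j\<close>. With \<open>z\<close> constant it yields a conserved
  quantity, with \<open>z\<close> the deviation from consensus it yields the dissipation.\<close>

lemma sum_antisymmetric:
  fixes f :: "'a \<Rightarrow> 'a \<Rightarrow> real"
  assumes "\<And>i j. i \<in> C \<Longrightarrow> j \<in> C \<Longrightarrow> f j i = - f i j"
  shows "2 * (\<Sum>i\<in>C. \<Sum>j\<in>C. z i * f i j) = - (\<Sum>i\<in>C. \<Sum>j\<in>C. (z j - z i) * f i j)"
proof -
  have "(\<Sum>i\<in>C. \<Sum>j\<in>C. z j * f i j) = (\<Sum>i\<in>C. \<Sum>j\<in>C. z i * f j i)"
    by (rule sum.swap)
  also have "\<dots> = - (\<Sum>i\<in>C. \<Sum>j\<in>C. z i * f i j)"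
    unfolding sum_negf[symmetric] by (intro sum.cong refl) (metis assms mult_minus_right)
  finally show ?thesis by (simp add: left_diff_distrib sum_subtractf)
qed

text \<open>Detail balance forces \<open>A $ i $ j\<close> and \<open>A $ j $ i\<close> to be positive together, so the symmetry of
  \<open>\<alpha>\<close> between mutual neighbours is available wherever a weight does not vanish.\<close>

lemma weighted_sig_antisymmetric:
  assumes "\<And>i j. 0 \<le> A $ i $ j"
    and "\<And>i. i \<in> C \<Longrightarrow> 0 < \<omega> i"
    and "\<And>i j. i \<in> C \<Longrightarrow> j \<in> C \<Longrightarrow> \<omega> i * A $ i $ j = \<omega> j * A $ j $ i"
    and "\<And>i j. j \<in> neighbors A i \<Longrightarrow> i \<in> neighbors A j \<Longrightarrow> \<alpha> i j = \<alpha> j i"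
    and "i \<in> C" "j \<in> C"
  shows "\<omega> j * A $ j $ i * sig (x $ i - x $ j) (\<alpha> j i)
    = - (\<omega> i * A $ i $ j * sig (x $ j - x $ i) (\<alpha> i j))"
proof (cases "i = j \<or> A $ i $ j = 0")
  case True
  then show ?thesis using assms(3)[OF assms(5,6)] by (auto simp: sig_def)
next
  case False
  then have "0 < A $ i $ j" using assms(1)[of i j] by simp
  then have "0 < \<omega> j * A $ j $ i"
    using assms(2)[OF assms(5)] assms(3)[OF assms(5,6)] by (metis mult_pos_pos)
  then have "0 < A $ j $ i" using assms(2)[OF assms(6)] by (simp add: zero_less_mult_iff)
  then have "\<alpha> i j = \<alpha> j i"
    using False \<open>0 < A $ i $ j\<close> by (intro assms(4)) (auto simp: neighbors_def)
  then show ?thesis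
    using assms(3)[OF assms(5,6)] sig_minus[of "x $ j - x $ i"] by simp
qed

lemma weighted_mean_conserved:
  assumes "\<And>i j. 0 \<le> A $ i $ j"
    and "\<And>i. i \<in> C \<Longrightarrow> 0 < \<omega> i"
    and "\<And>i j. i \<in> C \<Longrightarrow> j \<in> C \<Longrightarrow> \<omega> i * A $ i $ j = \<omega> j * A $ j $ i"
    and "\<And>i j. j \<in> neighbors A i \<Longrightarrow> i \<in> neighbors A j \<Longrightarrow> \<alpha> i j = \<alpha> j i"
    and closed: "\<And>i. i \<in> C \<Longrightarrow> neighbors A i \<subseteq> C"
  shows "(\<Sum>i\<in>C. \<omega> i * protocol A \<alpha> x $ i) = 0"
proof -
  define f where "f i j = \<omega> i * A $ i $ j * sig (x $ j - x $ i) (\<alpha> i j)" for i j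
  have anti: "f j i = - f i j" if "i \<in> C" "j \<in> C" for i j
    unfolding f_def using weighted_sig_antisymmetric[OF assms(1-4) that] by simp
  have "\<omega> i * protocol A \<alpha> x $ i = (\<Sum>j\<in>C. f i j)" if "i \<in> C" for i
  proof -
    have "f i j = 0" if "j \<notin> C" for j
      using that closed[OF \<open>i \<in> C\<close>] assms(1)[of i j] \<open>i \<in> C\<close> by (force simp: f_def neighbors_def)
    then have "(\<Sum>j\<in>C. f i j) = (\<Sum>j\<in>UNIV. f i j)" by (intro sum.mono_neutral_left) auto
    then show ?thesis
      by (simp add: protocol_nth[OF assms(1)] f_def sum_distrib_left mult.assoc)
  qed
  then have "(\<Sum>i\<in>C. \<omega> i * protocol A \<alpha> x $ i) = (\<Sum>i\<in>C. \<Sum>j\<in>C. 1 * f i j)" by simp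
  also have "\<dots> = 0"
    using sum_antisymmetric[of C f "\<lambda>_. 1", OF anti] by simp
  finally show ?thesis .
qed

text \<open>With \<open>V\<close> denoting the sum of \<open>\<omega> i * (x $ i - \<kappa>)\<^sup>2\<close> over \<open>C\<close>, the left-hand side is the time
  derivative of \<open>V\<close> along the protocol. Pairs inside \<open>C\<close> are handled by antisymmetry; a
  neighbour outside \<open>C\<close> already sits at \<open>\<kappa>\<close> and therefore pulls agent \<open>i\<close> towards \<open>\<kappa>\<close>. It
  contributes twice the amount listed on the right, hence an inequality only.\<close>

lemma dissipation_inequality:
  assumes "\<And>i j. 0 \<le> A $ i $ j"
    and "\<And>i. i \<in> C \<Longrightarrow> 0 < \<omega> i"
    and "\<And>i j. i \<in> C \<Longrightarrow> j \<in> C \<Longrightarrow> \<omega> i * A $ i $ j = \<omega> j * A $ j $ i"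
    and "\<And>i j. j \<in> neighbors A i \<Longrightarrow> i \<in> neighbors A j \<Longrightarrow> \<alpha> i j = \<alpha> j i"
    and outside: "\<And>i j. i \<in> C \<Longrightarrow> j \<in> neighbors A i \<Longrightarrow> j \<notin> C \<Longrightarrow> x $ j = \<kappa>"
  shows "2 * (\<Sum>i\<in>C. \<omega> i * (x $ i - \<kappa>) * protocol A \<alpha> x $ i)
    \<le> - (\<Sum>i\<in>C. \<Sum>j\<in>UNIV. \<omega> i * A $ i $ j * \<bar>x $ j - x $ i\<bar> powr (1 + \<alpha> i j))"
proof -
  define f where "f i j = \<omega> i * A $ i $ j * sig (x $ j - x $ i) (\<alpha> i j)" for i j
  define g where "g i j = \<omega> i * A $ i $ j * \<bar>x $ j - x $ i\<bar> powr (1 + \<alpha> i j)" for i j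
  define z where "z i = x $ i - \<kappa>" for i
  have fg: "(x $ j - x $ i) * f i j = g i j" for i j
    by (simp add: f_def g_def mult_sig[symmetric])
  have split: "sum h UNIV = sum h C + sum h (- C)" for h :: "'a \<Rightarrow> real"
    by (metis Compl_partition sum.union_disjoint finite Compl_disjoint)
  have anti: "f j i = - f i j" if "i \<in> C" "j \<in> C" for i j
    unfolding f_def using weighted_sig_antisymmetric[OF assms(1-4) that] by simp
  have inner: "2 * (\<Sum>i\<in>C. \<Sum>j\<in>C. z i * f i j) = - (\<Sum>i\<in>C. \<Sum>j\<in>C. g i j)"
    using sum_antisymmetric[of C f z, OF anti] by (simp add: z_def fg)
  have outer: "2 * (z i * f i j) \<le> - g i j" if "i \<in> C" "j \<in> - C" for i j
  proof (cases "A $ i $ j = 0")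
    case False
    then have "x $ j = \<kappa>"
      using that assms(1)[of i j] by (intro outside[OF that(1)]) (auto simp: neighbors_def)
    then have "z i * f i j = - g i j" using fg[of j i] by (simp add: z_def algebra_simps)
    moreover have "0 \<le> g i j" using assms(1,2) that by (simp add: g_def less_imp_le)
    ultimately show ?thesis by simp
  qed (simp add: f_def g_def)
  have "2 * (\<Sum>i\<in>C. \<omega> i * z i * protocol A \<alpha> x $ i) = 2 * (\<Sum>i\<in>C. \<Sum>j\<in>UNIV. z i * f i j)"
    by (simp add: protocol_nth[OF assms(1)] f_def sum_distrib_left algebra_simps)
  also have "\<dots> = 2 * (\<Sum>i\<in>C. \<Sum>j\<in>C. z i * f i j) + (\<Sum>i\<in>C. \<Sum>j\<in>-C. 2 * (z i * f i j))"
    by (simp add: split sum.distrib sum_distrib_left)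
  also have "\<dots> \<le> - (\<Sum>i\<in>C. \<Sum>j\<in>C. g i j) + (\<Sum>i\<in>C. \<Sum>j\<in>-C. - g i j)"
    unfolding inner by (intro add_left_mono sum_mono outer)
  also have "\<dots> = - (\<Sum>i\<in>C. \<Sum>j\<in>UNIV. g i j)"
    by (simp add: split sum.distrib sum_negf)
  finally show ?thesis by (simp add: g_def z_def)
qed

section \<open>Consensus inside one component\<close>

text \<open>Small powers of numbers below \<open>1\<close> dominate large ones. Dividing by an a priori bound \<open>B\<close>
  brings \<open>q\<close> into that range, so that edges with different exponents can be compared with a
  single one.\<close>

lemma powr_min_exponent_bound:
  fixes q B :: real
  assumes "0 < q" "q \<le> B" "1 \<le> B" "0 \<le> a" "a \<le> b"
  shows "(q / B) powr b \<le> q powr a"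
proof -
  have "(q / B) powr b \<le> (q / B) powr a"
    using assms by (intro powr_mono') auto
  also have "\<dots> \<le> q powr a"
    using assms by (intro powr_mono2) (auto simp: divide_le_eq mult_le_cancel_left1)
  finally show ?thesis .
qed

lemma solution_component_derivative:
  assumes "is_solution f X" "0 \<le> T" "T \<le> t"
  shows "((\<lambda>t. X t $ i) has_real_derivative f (X t) $ i) (at t within {T..})"
proof -
  have "(X has_vector_derivative f (X t)) (at t within {0..})"
    using assms by (simp add: is_solution_def)
  then have "(X has_vector_derivative f (X t)) (at t within {T..})"
    by (rule has_vector_derivative_within_subset) (use assms in auto)
  from bounded_linear.has_vector_derivative[OF bounded_linear_vec_nth this]
  show ?thesis by (simp add: has_real_derivative_iff_has_vector_derivative)
qed

text \<open>Outside influences on \<open>C\<close> are assumed to rest at \<open>\<kappa>\<close>; the assumption \<open>control\<close> says that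
  no agent of \<open>C\<close> is far from \<open>\<kappa>\<close> if all edges into \<open>C\<close> have small differences. Conversely, if
  the Lyapunov function \<open>V\<close> is positive then some edge into \<open>C\<close> has a difference of order
  \<open>sqrt (V t)\<close>, and that single edge dissipates at least a multiple of \<open>V t powr \<beta>\<close> with
  \<open>\<beta> = (1 + a) / 2 < 1\<close>, where \<open>a\<close> bounds the exponents. Hence \<open>V\<close> dies out in finite time.

  Stating \<open>control\<close> abstractly covers both a source component, where \<open>\<kappa>\<close> is the conserved
  mean, and a later component, where \<open>\<kappa>\<close> is imposed from outside.\<close>

lemma consensus_on_component:
  fixes A :: "real ^ 'n ^ 'n" and X :: "real \<Rightarrow> real ^ 'n"
  assumes nonneg: "\<And>i j. 0 \<le> A $ i $ j"
    and exponents: "\<And>i j. j \<in> neighbors A i \<Longrightarrow> \<alpha> i j \<in> {0<..<1}"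
    and pos: "\<And>i. i \<in> C \<Longrightarrow> 0 < \<omega> i"
    and balance: "\<And>i j. i \<in> C \<Longrightarrow> j \<in> C \<Longrightarrow> \<omega> i * A $ i $ j = \<omega> j * A $ j $ i"
    and sym: "\<And>i j. j \<in> neighbors A i \<Longrightarrow> i \<in> neighbors A j \<Longrightarrow> \<alpha> i j = \<alpha> j i"
    and solution: "is_solution (protocol A \<alpha>) X"
    and "0 \<le> T"
    and outside: "\<And>t i j. T \<le> t \<Longrightarrow> i \<in> C \<Longrightarrow> j \<in> neighbors A i \<Longrightarrow> j \<notin> C \<Longrightarrow> X t $ j = \<kappa>"
    and "0 < K"
    and control: "\<And>t d i. \<lbrakk>T \<le> t; 0 \<le> d; i \<in> C;
        \<And>i j. i \<in> C \<Longrightarrow> j \<in> neighbors A i \<Longrightarrow> \<bar>X t $ j - X t $ i\<bar> \<le> d\<rbrakk>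
      \<Longrightarrow> \<bar>X t $ i - \<kappa>\<bar> \<le> K * d"
  shows "\<exists>T'\<ge>T. \<forall>t\<ge>T'. \<forall>i\<in>C. X t $ i = \<kappa>"
proof -
  define V where "V t = (\<Sum>i\<in>C. \<omega> i * (X t $ i - \<kappa>)\<^sup>2)" for t
  define V' where "V' t = 2 * (\<Sum>i\<in>C. \<omega> i * (X t $ i - \<kappa>) * protocol A \<alpha> (X t) $ i)" for t
  define g where "g t i j = \<omega> i * A $ i $ j * \<bar>X t $ j - X t $ i\<bar> powr (1 + \<alpha> i j)" for t i j
  have V_nonneg: "0 \<le> V t" for t
    unfolding V_def using pos by (intro sum_nonneg) (simp add: less_imp_le)
  have g_nonneg: "0 \<le> g t i j" if "i \<in> C" for t i j
    using nonneg pos[OF that] by (simp add: g_def less_imp_le)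
  have V'_le: "V' t \<le> - (\<Sum>i\<in>C. \<Sum>j\<in>UNIV. g t i j)" if "T \<le> t" for t
    unfolding V'_def g_def
    by (rule dissipation_inequality[OF nonneg pos balance sym]) (use outside[OF that] in auto)
  have V'_le_edge: "V' t \<le> - g t i j" if "T \<le> t" "i \<in> C" for t i j
  proof -
    have "g t i j \<le> (\<Sum>j\<in>UNIV. g t i j)"
      using g_nonneg[OF that(2)] by (intro member_le_sum) auto
    also have "\<dots> \<le> (\<Sum>i\<in>C. \<Sum>j\<in>UNIV. g t i j)"
      using g_nonneg by (intro member_le_sum[OF that(2)] sum_nonneg) auto
    finally show ?thesis using V'_le[OF that(1)] by linarith
  qed
  have V'_nonpos: "V' t \<le> 0" if "T \<le> t" for t
  proof -
    have "0 \<le> (\<Sum>i\<in>C. \<Sum>j\<in>UNIV. g t i j)" using g_nonneg by (intro sum_nonneg) auto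
    then show ?thesis using V'_le[OF that] by linarith
  qed
  have X_deriv: "((\<lambda>t. X t $ i) has_real_derivative protocol A \<alpha> (X t) $ i) (at t within {T..})"
    if "T \<le> t" for t i
    by (rule solution_component_derivative[OF solution \<open>0 \<le> T\<close> that])
  have V_deriv: "(V has_real_derivative V' t) (at t within {T..})" if "T \<le> t" for t
    unfolding V_def V'_def
    by (auto intro!: derivative_eq_intros X_deriv[OF that] simp: sum_distrib_left algebra_simps
        intro: sum.cong)
  have V_le: "V t \<le> V T" if "T \<le> t" for t
    using mvt_upper_bound[of T t V V' 0] that V_deriv V'_nonpos by force
  \<comment> \<open>Inserting \<open>1\<close> and \<open>0\<close> keeps the extrema meaningful when no edge enters \<open>C\<close>.\<close>
  define P where "P = {(i, j). i \<in> C \<and> j \<in> neighbors A i}"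
  define m where "m = Min (insert 1 ((\<lambda>(i, j). \<omega> i * A $ i $ j) ` P))"
  define a where "a = Max (insert 0 ((\<lambda>(i, j). \<alpha> i j) ` P))"
  have "0 < m" unfolding m_def using pos by (auto simp: P_def neighbors_def)
  have m_le: "m \<le> \<omega> i * A $ i $ j" if "(i, j) \<in> P" for i j
    unfolding m_def using that by (intro Min_le) force+
  have "a < 1" unfolding a_def using exponents by (auto simp: P_def)
  have le_a: "\<alpha> i j \<le> a" if "(i, j) \<in> P" for i j
    unfolding a_def using that by (intro Max_ge) force+
  define W where "W = (\<Sum>i\<in>C. \<omega> i)"
  \<comment> \<open>The factor \<open>2\<close> makes differences below \<open>sqrt (V t / Q)\<close> imply \<open>V t \<le> V t / 2\<close>; the summand
    \<open>1\<close> keeps \<open>Q\<close> positive for empty \<open>C\<close>.\<close>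
  define Q where "Q = 2 * (W + 1) * K\<^sup>2"
  have "0 \<le> W" unfolding W_def using pos by (intro sum_nonneg) (simp add: less_imp_le)
  then have "0 < Q" using \<open>0 < K\<close> by (simp add: Q_def)
  define B where "B = max 1 (V T / Q)"
  define \<beta> where "\<beta> = (1 + a) / 2"
  have "V' t \<le> - (m * (Q * B) powr (- \<beta>) * V t powr \<beta>)" if "T \<le> t" "0 < V t" for t
  proof -
    define d where "d = sqrt (V t / Q)"
    have "0 < d" using that \<open>0 < Q\<close> by (simp add: d_def)
    have "\<exists>i j. (i, j) \<in> P \<and> d < \<bar>X t $ j - X t $ i\<bar>"
    proof (rule ccontr)
      assume small: "\<not> ?thesis"
      have "(X t $ i - \<kappa>)\<^sup>2 \<le> K\<^sup>2 * (V t / Q)" if "i \<in> C" for i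
      proof -
        have "\<bar>X t $ i - \<kappa>\<bar> \<le> K * d"
          using small \<open>T \<le> t\<close> \<open>0 < d\<close> that by (intro control) (force simp: P_def)+
        then have "\<bar>X t $ i - \<kappa>\<bar>\<^sup>2 \<le> (K * d)\<^sup>2" by (intro power_mono) auto
        then show ?thesis using V_nonneg[of t] \<open>0 < Q\<close> by (simp add: power_mult_distrib d_def)
      qed
      then have "(\<Sum>i\<in>C. \<omega> i * (X t $ i - \<kappa>)\<^sup>2) \<le> (\<Sum>i\<in>C. \<omega> i * (K\<^sup>2 * (V t / Q)))"
        using pos by (intro sum_mono mult_left_mono) (auto intro: less_imp_le)
      then have "V t \<le> (\<Sum>i\<in>C. \<omega> i * (K\<^sup>2 * (V t / Q)))"
        by (simp only: V_def[symmetric])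
      also have "\<dots> = W * K\<^sup>2 * (V t / Q)" by (simp only: W_def sum_distrib_right mult.assoc)
      also have "\<dots> \<le> (W + 1) * K\<^sup>2 * (V t / Q)"
        using \<open>0 < V t\<close> \<open>0 < Q\<close> by (intro mult_right_mono) auto
      also have "\<dots> = V t / 2"
        using \<open>0 < K\<close> \<open>0 \<le> W\<close> by (simp add: Q_def divide_simps)
      finally show False using \<open>0 < V t\<close> by simp
    qed
    then obtain i j where P: "(i, j) \<in> P" and large: "d < \<bar>X t $ j - X t $ i\<bar>" by blast
    then have "i \<in> C" "0 < \<alpha> i j" using exponents by (auto simp: P_def)
    have "(Q * B) powr (- \<beta>) * V t powr \<beta> = (V t / Q / B) powr \<beta>"
      using \<open>0 < Q\<close> V_nonneg[of t] by (simp add: B_def powr_divide powr_mult powr_minus field_simps)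
    also have "\<dots> \<le> (V t / Q) powr ((1 + \<alpha> i j) / 2)"
      using that \<open>0 < Q\<close> V_le[OF that(1)] \<open>0 < \<alpha> i j\<close> le_a[OF P]
      by (intro powr_min_exponent_bound) (auto simp: B_def \<beta>_def le_max_iff_disj divide_right_mono)
    also have "\<dots> = d powr (1 + \<alpha> i j)"
      using that \<open>0 < Q\<close> by (simp add: d_def powr_half_sqrt[symmetric] powr_powr)
    also have "\<dots> \<le> \<bar>X t $ j - X t $ i\<bar> powr (1 + \<alpha> i j)"
      using \<open>0 < d\<close> large \<open>0 < \<alpha> i j\<close> by (intro powr_mono2) auto
    finally have "m * ((Q * B) powr (- \<beta>) * V t powr \<beta>) \<le> g t i j"
      unfolding g_def using m_le[OF P] \<open>0 < m\<close> by (intro mult_mono) auto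
    then show ?thesis using V'_le_edge[OF that(1) \<open>i \<in> C\<close>, of j] by (simp add: mult.assoc)
  qed
  moreover have "0 < m * (Q * B) powr (- \<beta>)" using \<open>0 < m\<close> \<open>0 < Q\<close> by (simp add: B_def)
  moreover have "\<beta> < 1" using \<open>a < 1\<close> by (simp add: \<beta>_def)
  ultimately obtain T' where T': "T \<le> T'" "\<And>t. T' \<le> t \<Longrightarrow> V t = 0"
    using finite_time_extinction[of T V V' "m * (Q * B) powr (- \<beta>)" \<beta>]
      V_deriv V_nonneg V'_nonpos by blast
  show ?thesis
  proof (intro exI[of _ T'] conjI T'(1) allI impI ballI)
    fix t i assume "T' \<le> t" "i \<in> C"
    have "\<forall>i\<in>C. \<omega> i * (X t $ i - \<kappa>)\<^sup>2 = 0"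
      using T'(2)[OF \<open>T' \<le> t\<close>] pos unfolding V_def
      by (subst (asm) sum_nonneg_eq_0_iff) (auto simp: less_imp_le)
    with \<open>i \<in> C\<close> pos[OF \<open>i \<in> C\<close>] show "X t $ i = \<kappa>" by auto
  qed
qed

section \<open>The order of information flow\<close>

text \<open>The arcs of \<^const>\<open>graph_of\<close> as a plain relation, so that reflexive transitive closure and
  relational powers are available for paths.\<close>

definition influence :: "real ^ 'n ^ 'n \<Rightarrow> ('n \<times> 'n) set" where
  "influence A = {(j, i). 0 < A $ i $ j}"

lemma reachable_graph_of: "u \<rightarrow>\<^sup>*\<^bsub>graph_of A\<^esub> v \<longleftrightarrow> (u, v) \<in> (influence A)\<^sup>*"
proof -
  have "(u, v) \<in> rtrancl_on UNIV E \<longleftrightarrow> (u, v) \<in> E\<^sup>*" for E :: "('a \<times> 'a) set"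
  proof
    show "(u, v) \<in> E\<^sup>*" if "(u, v) \<in> rtrancl_on UNIV E"
      using that by (induction rule: rtrancl_on_induct) auto
    show "(u, v) \<in> rtrancl_on UNIV E" if "(u, v) \<in> E\<^sup>*"
      using that by (induction rule: rtrancl_induct) (auto intro: rtrancl_on_into_rtrancl_on)
  qed
  then show ?thesis by (simp add: reachable_def graph_of_def influence_def)
qed

definition strong_component :: "('a \<times> 'a) set \<Rightarrow> 'a \<Rightarrow> 'a set" where
  "strong_component E v = {i. (v, i) \<in> E\<^sup>* \<and> (i, v) \<in> E\<^sup>*}"

text \<open>Strongly connected components of the digraph are the induced subgraphs on the sets
  \<^const>\<open>strong_component\<close>; this transfers the hypothesis on subgraphs to vertex sets.\<close>

lemma strong_component_detail_balanced:
  fixes A :: "real ^ 'n ^ 'n" and v :: 'n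
  defines "C \<equiv> strong_component (influence A) v"
  assumes "\<And>H. H \<in> pre_digraph.sccs (graph_of A) \<Longrightarrow> detail_balanced A H"
  obtains \<omega> where "\<And>i. i \<in> C \<Longrightarrow> 0 < \<omega> i"
    "\<And>i j. i \<in> C \<Longrightarrow> j \<in> C \<Longrightarrow> \<omega> i * A $ i $ j = \<omega> j * A $ j $ i"
proof -
  interpret wf_digraph "graph_of A" by unfold_locales (auto simp: graph_of_def)
  have "scc_of v = C"
    by (simp add: C_def scc_of_def strong_component_def reachable_graph_of)
  moreover have "scc_of v \<in> sccs_verts"
    by (rule scc_of_in_sccs_verts) (simp add: graph_of_def)
  ultimately obtain H where "H \<in> sccs" "verts H = C"
    unfolding sccs_verts_conv by auto
  then obtain \<omega> where "\<forall>i\<in>C. 0 < \<omega> i"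
    "\<forall>i\<in>C. \<forall>j\<in>C. \<omega> i * A $ i $ j = \<omega> j * A $ j $ i"
    using assms(2)[of H] unfolding detail_balanced_def by auto
  then show thesis by (intro that[of \<omega>]) auto
qed

text \<open>A vertex with the fewest ancestors among those outside \<open>S\<close> lies in a component that receives
  information from itself and from \<open>S\<close> only: an ancestor outside \<open>S\<close> has no more ancestors than
  the vertex itself, hence by minimality exactly the same ones.\<close>

lemma source_component_exists:
  fixes E :: "('n::finite \<times> 'n) set"
  assumes "S \<noteq> UNIV"
  obtains v where "v \<notin> S" "\<And>u. u \<notin> S \<Longrightarrow> (u, v) \<in> E\<^sup>* \<Longrightarrow> (v, u) \<in> E\<^sup>*"
proof -
  define anc where "anc v = {u. (u, v) \<in> E\<^sup>*}" for v
  obtain v where v: "v \<notin> S" "\<And>u. u \<notin> S \<Longrightarrow> card (anc v) \<le> card (anc u)"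
    using ex_has_least_nat[of "\<lambda>v. v \<notin> S" _ "\<lambda>v. card (anc v)"] assms by (metis UNIV_eq_I)
  show thesis
  proof (rule that[OF v(1)])
    fix u assume u: "u \<notin> S" "(u, v) \<in> E\<^sup>*"
    then have "anc u \<subseteq> anc v" by (auto simp: anc_def)
    then have "anc u = anc v" using v(2)[OF u(1)] by (intro card_seteq) auto
    then show "(v, u) \<in> E\<^sup>*" by (auto simp: anc_def)
  qed
qed

lemma backward_closed_rtrancl:
  assumes "\<And>j i. (j, i) \<in> E \<Longrightarrow> i \<in> S \<Longrightarrow> j \<in> S" "(u, i) \<in> E\<^sup>*" "i \<in> S"
  shows "u \<in> S"
  using assms(2,3) by (induction rule: converse_rtrancl_induct) (auto intro: assms(1))

text \<open>A path ending in an ancestor-closed set never leaves it, and in a finite graph it can be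
  chosen with at most \<open>card E\<close> steps. The extra \<open>1\<close> keeps the constant positive even if there are
  no edges.\<close>

lemma path_difference_bound:
  fixes E :: "('n::finite \<times> 'n) set" and x :: "'n \<Rightarrow> real"
  assumes closed: "\<And>j i. (j, i) \<in> E \<Longrightarrow> i \<in> S \<Longrightarrow> j \<in> S"
    and steps: "\<And>j i. (j, i) \<in> E \<Longrightarrow> i \<in> S \<Longrightarrow> \<bar>x j - x i\<bar> \<le> d"
    and "0 \<le> d" "(u, i) \<in> E\<^sup>*" "i \<in> S"
  shows "\<bar>x u - x i\<bar> \<le> (1 + real (card E)) * d"
proof -
  have path: "i \<in> S \<Longrightarrow> \<bar>x u - x i\<bar> \<le> real n * d" if "(u, i) \<in> E ^^ n" for u i n
    using that
  proof (induction n arbitrary: i)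
    case (Suc n)
    then obtain k where "(u, k) \<in> E ^^ n" "(k, i) \<in> E" by auto
    with Suc.IH[of k] steps[of k i] closed[of k i] Suc.prems(1) show ?case
      by (simp add: algebra_simps)
  qed simp
  from \<open>(u, i) \<in> E\<^sup>*\<close> obtain n where n: "n \<le> card E" "(u, i) \<in> E ^^ n"
    using rtrancl_finite_eq_relpow[of E] by auto
  from path[OF n(2) \<open>i \<in> S\<close>] have "\<bar>x u - x i\<bar> \<le> real n * d" .
  also have "\<dots> \<le> (1 + real (card E)) * d" using n(1) \<open>0 \<le> d\<close> by (intro mult_right_mono) auto
  finally show ?thesis .
qed

lemma weighted_mean_distance:
  fixes x \<omega> :: "'n \<Rightarrow> real"
  assumes "finite C" "i \<in> C" and pos: "\<And>j. j \<in> C \<Longrightarrow> 0 < \<omega> j"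
    and near: "\<And>j. j \<in> C \<Longrightarrow> \<bar>x j - x i\<bar> \<le> D"
  shows "\<bar>x i - (\<Sum>j\<in>C. \<omega> j * x j) / (\<Sum>j\<in>C. \<omega> j)\<bar> \<le> D"
proof -
  define W where "W = (\<Sum>j\<in>C. \<omega> j)"
  have "0 < W" unfolding W_def using assms by (intro sum_pos) auto
  have "W * x i - (\<Sum>j\<in>C. \<omega> j * x j) = (\<Sum>j\<in>C. \<omega> j * (x i - x j))"
    by (simp add: W_def sum_distrib_right right_diff_distrib sum_subtractf)
  also have "\<bar>\<dots>\<bar> \<le> (\<Sum>j\<in>C. \<bar>\<omega> j * (x i - x j)\<bar>)" by (rule sum_abs)
  also have "\<dots> \<le> (\<Sum>j\<in>C. \<omega> j * D)"
    using pos near by (intro sum_mono) (simp add: abs_mult abs_minus_commute less_imp_le)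
  also have "\<dots> = W * D" by (simp add: W_def sum_distrib_right)
  finally have "\<bar>W * x i - (\<Sum>j\<in>C. \<omega> j * x j)\<bar> \<le> W * D" .
  moreover have "x i - (\<Sum>j\<in>C. \<omega> j * x j) / W = (W * x i - (\<Sum>j\<in>C. \<omega> j * x j)) / W"
    using \<open>0 < W\<close> by (simp add: diff_divide_distrib)
  ultimately show ?thesis
    using \<open>0 < W\<close> by (simp add: W_def[symmetric] divide_le_eq mult.commute)
qed

section \<open>Spreading consensus through the graph\<close>

text \<open>The sets on which the induction over components runs: closed under taking ancestors, so that
  their dynamics is autonomous, and resting at a common value from some time on.\<close>

definition ancestral_consensus :: "real ^ 'n ^ 'n \<Rightarrow> (real \<Rightarrow> real ^ 'n) \<Rightarrow> 'n set \<Rightarrow> bool" where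
  "ancestral_consensus A X S \<longleftrightarrow>
    (\<forall>j i. (j, i) \<in> influence A \<longrightarrow> i \<in> S \<longrightarrow> j \<in> S) \<and>
    (\<exists>T \<kappa>. 0 \<le> T \<and> (\<forall>t\<ge>T. \<forall>i\<in>S. X t $ i = \<kappa>))"

text \<open>A source component \<open>C\<close> of the complement of \<open>S\<close> can be added. If \<open>S\<close> is nonempty it contains
  the root \<open>r\<close>, whose value \<open>\<kappa>\<close> is attained, and every agent of \<open>C\<close> is joined to \<open>r\<close> by a path
  along which only edges into \<open>C\<close> carry nonzero differences. If \<open>S\<close> is empty, \<open>C\<close> is closed,
  its weighted mean is constant in time, and any two agents of \<open>C\<close> are joined by a path in \<open>C\<close>.\<close>

lemma ancestral_consensus_grows:
  fixes A :: "real ^ 'n ^ 'n" and X :: "real \<Rightarrow> real ^ 'n"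
  assumes nonneg: "\<And>i j. 0 \<le> A $ i $ j"
    and "\<And>i. A $ i $ i = 0"
    and exponents: "\<And>i j. j \<in> neighbors A i \<Longrightarrow> \<alpha> i j \<in> {0<..<1}"
    and balanced: "\<And>H. H \<in> pre_digraph.sccs (graph_of A) \<Longrightarrow> detail_balanced A H"
    and sym: "\<And>i j. j \<in> neighbors A i \<Longrightarrow> i \<in> neighbors A j \<Longrightarrow> \<alpha> i j = \<alpha> j i"
    and solution: "is_solution (protocol A \<alpha>) X"
    and root: "\<And>i. (r, i) \<in> (influence A)\<^sup>*"
    and S: "ancestral_consensus A X S"
    and "S \<noteq> UNIV"
  shows "\<exists>S'. S \<subset> S' \<and> ancestral_consensus A X S'"
proof -
  let ?E = "influence A"
  have closed: "j \<in> S" if "(j, i) \<in> ?E" "i \<in> S" for i j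
    using S that by (auto simp: ancestral_consensus_def)
  obtain T \<kappa> where "0 \<le> T" and settled: "\<And>t i. T \<le> t \<Longrightarrow> i \<in> S \<Longrightarrow> X t $ i = \<kappa>"
    using S by (auto simp: ancestral_consensus_def)
  have neighbors_iff: "j \<in> neighbors A i \<longleftrightarrow> (j, i) \<in> ?E" for i j
    using assms(2)[of i] by (auto simp: neighbors_def influence_def)
  obtain v where v: "v \<notin> S" "\<And>u. u \<notin> S \<Longrightarrow> (u, v) \<in> ?E\<^sup>* \<Longrightarrow> (v, u) \<in> ?E\<^sup>*"
    using source_component_exists[OF \<open>S \<noteq> UNIV\<close>] by metis
  define C where "C = strong_component ?E v"
  then have C_eq: "C = {i. (v, i) \<in> ?E\<^sup>* \<and> (i, v) \<in> ?E\<^sup>*}"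
    by (simp add: strong_component_def)
  then have "v \<in> C" by simp
  have "C \<inter> S = {}" using backward_closed_rtrancl[OF closed] v(1) by (auto simp: C_eq)
  have into_C: "j \<in> S \<union> C" if "(j, i) \<in> ?E" "i \<in> C" for i j
    using that v(2)[of j] by (auto simp: C_eq intro: converse_rtrancl_into_rtrancl)
  then have closed': "j \<in> S \<union> C" if "(j, i) \<in> ?E" "i \<in> S \<union> C" for i j
    using that closed by blast
  obtain \<omega> where pos: "\<And>i. i \<in> C \<Longrightarrow> 0 < \<omega> i"
    and balance: "\<And>i j. i \<in> C \<Longrightarrow> j \<in> C \<Longrightarrow> \<omega> i * A $ i $ j = \<omega> j * A $ j $ i"
    using strong_component_detail_balanced[OF balanced, of v] unfolding C_def by metis
  define K where "K = 1 + real (card ?E)"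
  have "0 < K" by (simp add: K_def)
  have outside: "X t $ j = \<kappa>" if "T \<le> t" "i \<in> C" "j \<in> neighbors A i" "j \<notin> C" for t i j
    using settled[OF that(1), of j] into_C[of j i] that by (auto simp: neighbors_iff)
  have path: "\<bar>X t $ u - X t $ i\<bar> \<le> K * d"
    if "T \<le> t" "0 \<le> d" "i \<in> C" "(u, i) \<in> ?E\<^sup>*"
      and small: "\<And>i j. i \<in> C \<Longrightarrow> j \<in> neighbors A i \<Longrightarrow> \<bar>X t $ j - X t $ i\<bar> \<le> d" for t d i u
    unfolding K_def
  proof (rule path_difference_bound[of ?E "S \<union> C" "($) (X t)"])
    show "\<bar>X t $ j - X t $ i\<bar> \<le> d" if "(j, i) \<in> ?E" "i \<in> S \<union> C" for j i
      using that small[of i j] settled[OF \<open>T \<le> t\<close>] closed[OF that(1)] \<open>0 \<le> d\<close>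
      by (auto simp: neighbors_iff)
  qed (use that closed' in auto)
  have "\<exists>\<kappa>'. \<exists>T'\<ge>T. \<forall>t\<ge>T'. \<forall>i\<in>S \<union> C. X t $ i = \<kappa>'"
  proof (cases "S = {}")
    case False
    then obtain s where "s \<in> S" by blast
    then have "r \<in> S" using closed by (rule backward_closed_rtrancl[OF _ root, rotated])
    have near: "\<bar>X t $ i - \<kappa>\<bar> \<le> K * d"
      if "T \<le> t" "0 \<le> d" "i \<in> C"
        "\<And>i j. i \<in> C \<Longrightarrow> j \<in> neighbors A i \<Longrightarrow> \<bar>X t $ j - X t $ i\<bar> \<le> d" for t d i
      using path[OF that(1-3) root that(4)] settled[OF \<open>T \<le> t\<close> \<open>r \<in> S\<close>]
      by (simp add: abs_minus_commute)
    have "\<exists>T'\<ge>T. \<forall>t\<ge>T'. \<forall>i\<in>C. X t $ i = \<kappa>"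
      by (rule consensus_on_component[of A \<alpha> C \<omega> X T \<kappa> K])
        (fact nonneg exponents pos balance sym solution \<open>0 \<le> T\<close> outside \<open>0 < K\<close> near)+
    then obtain T' where "T \<le> T'" "\<forall>t\<ge>T'. \<forall>i\<in>C. X t $ i = \<kappa>" by blast
    then show ?thesis using settled by (intro exI[of _ \<kappa>] exI[of _ T']) auto
  next
    case True
    then have closed_C: "neighbors A i \<subseteq> C" if "i \<in> C" for i
      using into_C[OF _ that] by (auto simp: neighbors_iff)
    define \<mu> where "\<mu> t = (\<Sum>j\<in>C. \<omega> j * X t $ j)" for t
    have "(\<mu> has_real_derivative 0) (at t within {T..})" if "T \<le> t" for t
    proof -
      have "(\<mu> has_real_derivative (\<Sum>j\<in>C. \<omega> j * protocol A \<alpha> (X t) $ j)) (at t within {T..})"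
        unfolding \<mu>_def
        by (intro DERIV_sum DERIV_cmult solution_component_derivative[OF solution \<open>0 \<le> T\<close> that])
      then show ?thesis
        by (subst (asm) weighted_mean_conserved)
          (fact nonneg pos balance sym closed_C | assumption)+
    qed
    then have "\<exists>c. \<forall>t\<in>{T..}. \<mu> t = c"
      by (intro has_field_derivative_zero_constant) auto
    then obtain c where c: "\<And>t. T \<le> t \<Longrightarrow> \<mu> t = c" by auto
    define \<kappa>' where "\<kappa>' = c / (\<Sum>j\<in>C. \<omega> j)"
    have near: "\<bar>X t $ i - \<kappa>'\<bar> \<le> K * d"
      if "T \<le> t" "0 \<le> d" "i \<in> C"
      and small: "\<And>i j. i \<in> C \<Longrightarrow> j \<in> neighbors A i \<Longrightarrow> \<bar>X t $ j - X t $ i\<bar> \<le> d" for t d i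
    proof -
      have "\<bar>X t $ j - X t $ i\<bar> \<le> K * d" if "j \<in> C" for j
      proof (rule path[OF \<open>T \<le> t\<close> \<open>0 \<le> d\<close> \<open>i \<in> C\<close> _ small])
        show "(j, i) \<in> ?E\<^sup>*"
          using \<open>i \<in> C\<close> \<open>j \<in> C\<close> unfolding C_eq by (auto intro: rtrancl_trans)
      qed
      from weighted_mean_distance[of C i \<omega> "($) (X t)", OF _ \<open>i \<in> C\<close> pos this]
      show ?thesis using c[OF \<open>T \<le> t\<close>] by (simp add: \<kappa>'_def \<mu>_def)
    qed
    have outside': "X t $ j = \<kappa>'" if "T \<le> t" "i \<in> C" "j \<in> neighbors A i" "j \<notin> C" for t i j
      using closed_C that by blast
    have "\<exists>T'\<ge>T. \<forall>t\<ge>T'. \<forall>i\<in>C. X t $ i = \<kappa>'"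
      by (rule consensus_on_component[of A \<alpha> C \<omega> X T \<kappa>' K])
        (fact nonneg exponents pos balance sym solution \<open>0 \<le> T\<close> outside' \<open>0 < K\<close> near)+
    then show ?thesis using True by auto
  qed
  then obtain \<kappa>' T' where T': "T \<le> T'" "\<forall>t\<ge>T'. \<forall>i\<in>S \<union> C. X t $ i = \<kappa>'" by blast
  have "0 \<le> T'" using \<open>0 \<le> T\<close> T'(1) by simp
  then have "ancestral_consensus A X (S \<union> C)"
    unfolding ancestral_consensus_def using closed' T'(2) by blast
  moreover have "S \<subset> S \<union> C" using \<open>v \<in> C\<close> v(1) by blast
  ultimately show ?thesis by blast
qed

theorem theorem4:
  fixes A :: "real ^ 'n ^ 'n" and \<alpha> :: "'n \<Rightarrow> 'n \<Rightarrow> real"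
  assumes "\<And>i j. A $ i $ j \<ge> 0"
    and "\<And>i. A $ i $ i = 0"
    and "\<And>i j. j \<in> neighbors A i \<Longrightarrow> \<alpha> i j \<in> {0<..<1}"
    and "has_spanning_tree (graph_of A)"
    and "\<And>H. H \<in> pre_digraph.sccs (graph_of A) \<Longrightarrow> detail_balanced A H"
    and "\<And>i j. j \<in> neighbors A i \<Longrightarrow> i \<in> neighbors A j \<Longrightarrow> \<alpha> i j = \<alpha> j i"
  shows "solves_finite_time_consensus (protocol A \<alpha>)"
proof -
  obtain r where "\<And>i. i \<noteq> r \<Longrightarrow> (r, i) \<in> (influence A)\<^sup>*"
    using assms(4) unfolding has_spanning_tree_def reachable_graph_of
    by (auto simp: graph_of_def)
  then have root: "(r, i) \<in> (influence A)\<^sup>*" for i by (cases "i = r") auto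
  have consensus: "\<exists>T \<kappa>. 0 \<le> T \<and> (\<forall>t\<ge>T. \<forall>i. X t $ i = \<kappa>)"
    if solution: "is_solution (protocol A \<alpha>) X" for X
  proof -
    have "ancestral_consensus A X {}" by (auto simp: ancestral_consensus_def)
    then obtain S where S: "ancestral_consensus A X S"
        "\<And>S'. ancestral_consensus A X S' \<Longrightarrow> \<not> S \<subset> S'"
      using finite_has_maximal[of "Collect (ancestral_consensus A X)"] by auto
    have "S = UNIV"
    proof (rule ccontr)
      assume "S \<noteq> UNIV"
      have "\<exists>S'. S \<subset> S' \<and> ancestral_consensus A X S'"
        by (rule ancestral_consensus_grows[of A \<alpha> X r])
          (fact assms(1-3,5,6) solution root S(1) \<open>S \<noteq> UNIV\<close>)+
      with S(2) show False by blast
    qed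
    with S(1) show ?thesis by (auto simp: ancestral_consensus_def)
  qed
  show ?thesis
    unfolding solves_finite_time_consensus_def
  proof (intro allI impI conjI)
    fix x0 X assume X: "is_solution (protocol A \<alpha>) X \<and> X 0 = x0"
    show "\<exists>T \<kappa>. T \<ge> 0 \<and> (\<forall>t\<ge>T. \<forall>j. X t $ j = \<kappa>)"
      by (rule consensus[OF conjunct1[OF X]])
    then obtain T \<kappa> where T: "\<forall>t\<ge>T. \<forall>i. X t $ i = \<kappa>" by blast
    have "\<forall>\<^sub>F t in at_top. \<bar>X t $ j - X t $ k\<bar> = 0" for j k
      using eventually_ge_at_top[of T] by eventually_elim (simp add: T)
    then show "((\<lambda>t. \<bar>X t $ j - X t $ k\<bar>) \<longlongrightarrow> 0) at_top" for j k
      by (rule tendsto_eventually)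
  qed
qed

end
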